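(* Let $\Gamma\subset\mathbb{R}^2$ be a piecewise $\mathcal C^1$ curve with piecewise bi-Lipschitz continuous unit tangent vectors. Then there is a constant $c>0$ such that for all $n\ge1$, $$\operatorname{Fav}_\Gamma(\mathcal K_n)\ge\frac{c}{n}.$$
   Context: $\mathcal K_n$ is the $n$-th generation in the construction of the four corner Cantor set: $\mathcal K_0=[0,1]^2$; $\mathcal K_1$ is obtained by dividing the unit square into 16 axis-parallel closed squares of side length $1/4$ and keeping the four corner ones; and $\mathcal K_{n+1}$ is obtained by repeating this within each square of $\mathcal K_n$. Thus $\mathcal K_n$ is a union of $4^n$ closed squares of side length $4^{-n}$. For $\alpha\in\mathbb{R}$ and $p\in\mathbb{R}^2$ let $\Phi_\alpha(p)=\{\beta\in\mathbb{R}:(\alpha,\beta)\in p+\Gamma\}$, and $\Phi_\alpha(S)=\bigcup_{p\in S}\Phi_\alpha(p)$ for $S\subseteq\mathbb{R}^2$. The Favard curve length of $S$ is $\operatorname{Fav}_\Gamma(S)=\int_{\mathbb{R}}|\Phi_\alpha(S)|\,d\alpha=|S+\Gamma|$, with $|\cdot|$ Lebesgue measure of the appropriate dimension. "Piecewise $\mathcal C^1$ curve with piecewise bi-Lipschitz continuous unit tangent vectors" means that $\Gamma$ is a (nonempty, at most countable) disjoint union of continuous nondegenerate subcurves $\Gamma_i$, each a $\mathcal C^1$ curve of finite length whose unit tangent vector is a bi-Lipschitz function of the parameter (arclength). *)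

theory Defs
  imports "HOL-Analysis.Analysis"
begin

text \<open>
  Lower left corners of the squares of the \<open>n\<close>-th generation. A square of side
  \<open>4\<^sup>-\<^sup>n\<close> with lower left corner \<open>(x, y)\<close> has its four corner
  subsquares (of side \<open>1 / 4 ^ Suc n\<close>) based at \<open>(x, y)\<close> shifted by \<open>0\<close> or
  \<open>3 / 4 ^ Suc n\<close> in each coordinate.
\<close>

primrec cantor_corners :: "nat \<Rightarrow> (real \<times> real) set" where
  "cantor_corners 0 = {(0, 0)}"
| "cantor_corners (Suc n) =
     {(x + a, y + b) | x y a b.
        (x, y) \<in> cantor_corners n \<and> a \<in> {0, 3 / 4 ^ Suc n} \<and> b \<in> {0, 3 / 4 ^ Suc n}}"

definition four_corner_cantor :: "nat \<Rightarrow> (real \<times> real) set" where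
  "four_corner_cantor n =
     (\<Union>(x, y)\<in>cantor_corners n. {x..x + 1 / 4 ^ n} \<times> {y..y + 1 / 4 ^ n})"

definition curve_proj_point :: "(real \<times> real) set \<Rightarrow> real \<Rightarrow> real \<times> real \<Rightarrow> real set" where
  "curve_proj_point \<Gamma> \<alpha> p = {\<beta>. (\<alpha>, \<beta>) \<in> (+) p ` \<Gamma>}"

definition curve_proj :: "(real \<times> real) set \<Rightarrow> real \<Rightarrow> (real \<times> real) set \<Rightarrow> real set" where
  "curve_proj \<Gamma> \<alpha> S = (\<Union>p\<in>S. curve_proj_point \<Gamma> \<alpha> p)"

text \<open>
  The value is an extended nonnegative real, because a curve with infinitely many pieces may
  have infinite Favard curve length.
\<close>

definition favard_curve_length :: "(real \<times> real) set \<Rightarrow> (real \<times> real) set \<Rightarrow> ennreal" where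
  "favard_curve_length \<Gamma> S = (\<integral>\<^sup>+ \<alpha>. emeasure lebesgue (curve_proj \<Gamma> \<alpha> S) \<partial>lebesgue)"

definition bi_lipschitz_on :: "'a::metric_space set \<Rightarrow> ('a \<Rightarrow> 'b::metric_space) \<Rightarrow> bool" where
  "bi_lipschitz_on A f \<longleftrightarrow>
     (\<exists>L>0. \<forall>x\<in>A. \<forall>y\<in>A. dist x y / L \<le> dist (f x) (f y) \<and> dist (f x) (f y) \<le> L * dist x y)"

text \<open>
  A single piece, given by its arclength parametrization \<open>\<gamma>\<close> with unit tangent \<open>T\<close>. Since
  \<open>\<gamma>\<close> has unit speed, boundedness of the parameter interval \<open>I\<close> says that the length is finite.
  The interval may be open, half-open or closed, so that pieces meeting at a corner can be made
  disjoint; at an endpoint belonging to \<open>I\<close> the derivative is one-sided.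
\<close>

definition bi_lipschitz_tangent_curve :: "(real \<times> real) set \<Rightarrow> bool" where
  "bi_lipschitz_tangent_curve C \<longleftrightarrow>
     (\<exists>(I :: real set) \<gamma> T.
        is_interval I \<and> bounded I \<and> (\<exists>a\<in>I. \<exists>b\<in>I. a < b) \<and>
        (\<forall>s\<in>I. (\<gamma> has_vector_derivative T s) (at s within I)) \<and>
        continuous_on I T \<and>
        (\<forall>s\<in>I. norm (T s) = 1) \<and>
        bi_lipschitz_on I T \<and>
        C = \<gamma> ` I)"

definition piecewise_bi_lipschitz_tangent_curve :: "(real \<times> real) set \<Rightarrow> bool" where
  "piecewise_bi_lipschitz_tangent_curve \<Gamma> \<longleftrightarrow>
     (\<exists>\<C>. \<C> \<noteq> {} \<and> countable \<C> \<and> disjoint \<C> \<and>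
        (\<forall>C\<in>\<C>. bi_lipschitz_tangent_curve C) \<and> \<Gamma> = \<Union>\<C>)"

end

(*
  Some short arc of the curve is the graph over an interval [a, b] of a Lipschitz function f
  whose slope expands distances: the unit tangent is injective, hence not always vertical, and
  near a non-vertical tangent the slope determines the tangent up to a Lipschitz factor.

  Let delta = 4^-n. Replacing every square by its left edge, the slice at alpha of the sum of the
  Cantor set and this graph contains 4^n intervals of length delta, one for each lower left
  corner p. For p ~= q the corresponding intervals overlap only for a set of alpha of length
  O(delta / |p - q|), since the increments of f are transversal by the expansion of the slope.
  By self-similarity the sum of 1 / |p - q| over pairs of corners is at most 2 n 16^n. So the
  overlap function N has total integral b - a, and the integral of its square is O(n). As
  2 t N - t^2 N^2 is at most the indicator function of the support of N, optimizing over t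
  bounds the area of that support from below by a constant times (b - a)^2 / n.
*)
theory Submission
  imports Defs
begin

subsection \<open>Energy of the corners\<close>

text \<open>This metric splits a displacement into its horizontal and vertical parts, which a
  Lipschitz bound on \<open>f\<close> compares directly.\<close>

definition l1_dist :: "real \<times> real \<Rightarrow> real \<times> real \<Rightarrow> real" where
  "l1_dist p q = \<bar>fst p - fst q\<bar> + \<bar>snd p - snd q\<bar>"

lemma l1_dist_translate_scale:
  "l1_dist (c + (1/4) *\<^sub>R p) (c + (1/4) *\<^sub>R q) = l1_dist p q / 4"
proof -
  have *: "\<bar>1 / 4 * a - 1 / 4 * b\<bar> = \<bar>a - b\<bar> / 4" for a b :: real
    by (simp flip: diff_divide_distrib)
  then show ?thesis unfolding l1_dist_def by (simp only: fst_add snd_add fst_scaleR snd_scaleR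
      add_diff_cancel_left add_divide_distrib) (simp only: real_scaleR_def * add_divide_distrib)
qed

text \<open>The sharp right end lets the induction close: adding the new offset
  \<open>3 / 4 ^ Suc n\<close> to \<open>1 - 1 / 4 ^ n\<close> gives exactly
  \<open>1 - 1 / 4 ^ Suc n\<close>.\<close>

lemma cantor_corners_subset: "cantor_corners n \<subseteq> {0..1 - 1 / 4 ^ n} \<times> {0..1 - 1 / 4 ^ n}"
proof (induction n)
  case (Suc n)
  define d where "d = 3 / (4 ^ Suc n :: real)"
  have d: "1 - 1 / 4 ^ Suc n = 1 - 1 / 4 ^ n + d" "0 \<le> d"
    unfolding d_def by (simp_all add: field_simps)
  show ?case
    unfolding cantor_corners.simps(2) d d_def[symmetric] using Suc d(2) by fastforce
qed simp

definition corner_offsets :: "nat \<Rightarrow> (real \<times> real) set" where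
  "corner_offsets k = {0, 3 / 4 ^ k} \<times> {0, 3 / 4 ^ k}"

lemma card_corner_offsets: "card (corner_offsets k) = 4"
  by (simp add: corner_offsets_def card_cartesian_product)

lemma finite_corner_offsets [simp]: "finite (corner_offsets k)"
  by (simp add: corner_offsets_def)

lemma corner_offsets_Suc: "corner_offsets (Suc k) = (*\<^sub>R) (1/4) ` corner_offsets k"
  by (auto simp: corner_offsets_def image_iff)

lemma cantor_corners_Suc:
  "cantor_corners (Suc n) = {p + s | p s. p \<in> cantor_corners n \<and> s \<in> corner_offsets (Suc n)}"
  unfolding corner_offsets_def cantor_corners.simps(2) by force

lemma image_case_prod_Times:
  "(\<lambda>(c, p). g c p) ` (A \<times> B) = {g c p | c p. c \<in> A \<and> p \<in> B}"
  by auto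

text \<open>The defining recursion refines at the finest scale, whereas the energy estimate splits
  at the coarsest one. Scaling by 1/4 carries the offsets of one generation to those of the next, so
  the two descriptions agree by induction.\<close>

lemma cantor_corners_self_similar:
  "cantor_corners (Suc n) =
     (\<lambda>(c, p). c + (1/4) *\<^sub>R p) ` (corner_offsets 1 \<times> cantor_corners n)"
proof (induction n)
  case 0
  have 0: "cantor_corners 0 = {0}" by (simp add: zero_prod_def)
  show ?case
    unfolding cantor_corners_Suc 0 image_case_prod_Times by (simp del: split_paired_Ex)
next
  case (Suc n)
  have "cantor_corners (Suc (Suc n)) =
      {(c + (1/4) *\<^sub>R p) + (1/4) *\<^sub>R s | c p s.
        c \<in> corner_offsets 1 \<and> p \<in> cantor_corners n \<and> s \<in> corner_offsets (Suc n)}"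
    unfolding cantor_corners_Suc[of "Suc n"] Suc corner_offsets_Suc[of "Suc n"]
      image_case_prod_Times by blast
  also have "\<dots> = {c + (1/4) *\<^sub>R (p + s) | c p s.
        c \<in> corner_offsets 1 \<and> p \<in> cantor_corners n \<and> s \<in> corner_offsets (Suc n)}"
    by (simp only: scaleR_add_right add.assoc)
  also have "\<dots> = (\<lambda>(c, p). c + (1/4) *\<^sub>R p) ` (corner_offsets 1 \<times> cantor_corners (Suc n))"
    unfolding cantor_corners_Suc[of n] image_case_prod_Times by blast
  finally show ?case .
qed

text \<open>In some coordinate \<open>c\<close> and \<open>d\<close> differ by 3/4, and the scaled
  points can undo at most 1/4 of that.\<close>

lemma l1_dist_distinct_corners:
  assumes "c \<in> corner_offsets 1" "d \<in> corner_offsets 1" "c \<noteq> d"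
    and "p \<in> cantor_corners n" "q \<in> cantor_corners n"
  shows "l1_dist (c + (1/4) *\<^sub>R p) (d + (1/4) *\<^sub>R q) \<ge> 1/2"
proof -
  have "{0..1 - 1 / 4 ^ n :: real} \<subseteq> {0..1}" by simp
  then have "p \<in> {0..1} \<times> {0..1}" "q \<in> {0..1} \<times> {0..1}"
    using assms(4,5) cantor_corners_subset[of n] by blast+
  then have "\<bar>fst p - fst q\<bar> \<le> 1" "\<bar>snd p - snd q\<bar> \<le> 1" by auto
  then show ?thesis using assms(1-3) unfolding l1_dist_def corner_offsets_def by (auto simp: abs_if split: if_splits)
qed

text \<open>A point determines its first-generation square, since distinct squares are at positive
  distance; the rest is cancellation.\<close>

lemma inj_on_cantor_corners_self_similar:
  "inj_on (\<lambda>(c, p). c + (1/4) *\<^sub>R p) (corner_offsets 1 \<times> cantor_corners n)"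
proof (rule inj_onI)
  fix cp dq assume cp: "cp \<in> corner_offsets 1 \<times> cantor_corners n"
    and dq: "dq \<in> corner_offsets 1 \<times> cantor_corners n"
    and eq: "(case cp of (c, p) \<Rightarrow> c + (1/4) *\<^sub>R p) = (case dq of (c, p) \<Rightarrow> c + (1/4) *\<^sub>R p)"
  obtain c p d q where *: "cp = (c, p)" "dq = (d, q)" by (metis surj_pair)
  have eq': "c + (1/4) *\<^sub>R p = d + (1/4) *\<^sub>R q" using eq * by simp
  then have "l1_dist (c + (1/4) *\<^sub>R p) (d + (1/4) *\<^sub>R q) = 0"
    unfolding l1_dist_def by simp
  then have "c = d"
    using l1_dist_distinct_corners[of c d p n q] cp dq * by force
  then show "cp = dq" using eq' * by simp
qed

lemma finite_cantor_corners [simp]: "finite (cantor_corners n)"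
  by (induction n) (simp_all add: cantor_corners_self_similar del: cantor_corners.simps(2))

lemma card_cantor_corners: "card (cantor_corners n) = 4 ^ n"
proof (induction n)
  case (Suc n)
  then show ?case
    unfolding cantor_corners_self_similar card_image[OF inj_on_cantor_corners_self_similar]
    by (simp add: card_cartesian_product card_corner_offsets)
qed simp

text \<open>Within one first-generation square the bound scales by 1/4; across squares the distance
  1/2 is already enough. The separation is twice the side length, the form in which
  \<open>overlap_dist_le\<close> requires it.\<close>

lemma cantor_corners_separated:
  "\<lbrakk>p \<in> cantor_corners n; q \<in> cantor_corners n; p \<noteq> q\<rbrakk> \<Longrightarrow> 2 / 4 ^ n \<le> l1_dist p q"
proof (induction n arbitrary: p q)
  case (Suc n)
  obtain c d p' q' where cd: "c \<in> corner_offsets 1" "d \<in> corner_offsets 1"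
    and pq': "p' \<in> cantor_corners n" "q' \<in> cantor_corners n"
    and p: "p = c + (1/4) *\<^sub>R p'" and q: "q = d + (1/4) *\<^sub>R q'"
    using Suc.prems(1,2) unfolding cantor_corners_self_similar by auto
  show ?case
  proof (cases "c = d")
    case True
    then show ?thesis
      using Suc.IH[OF pq'] Suc.prems(3) l1_dist_translate_scale[of c p' q'] p q by auto
  next
    case False
    have "2 / 4 ^ Suc n \<le> (1 / 2 :: real)" by (simp add: field_simps)
    then show ?thesis using l1_dist_distinct_corners[OF cd False pq'] unfolding p q by (rule order_trans)
  qed
qed simp

text \<open>The diagonal terms vanish because \<open>1 / 0 = 0\<close>.\<close>

lemma cantor_corners_energy:
  "(\<Sum>p\<in>cantor_corners n. \<Sum>q\<in>cantor_corners n. 1 / l1_dist p q) \<le> 2 * real n * 16 ^ n"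
proof (induction n)
  case 0
  show ?case by (simp add: l1_dist_def)
next
  case (Suc n)
  let ?P = "cantor_corners n" and ?C = "corner_offsets 1"
  let ?\<phi> = "\<lambda>c p. c + (1/4) *\<^sub>R p :: real \<times> real"
  have reindex: "sum g (cantor_corners (Suc n)) = (\<Sum>c\<in>?C. \<Sum>p\<in>?P. g (?\<phi> c p))"
    for g :: "real \<times> real \<Rightarrow> real"
    unfolding cantor_corners_self_similar sum.reindex[OF inj_on_cantor_corners_self_similar]
      sum.cartesian_product by (simp add: case_prod_unfold)
  \<comment> \<open>Inside one first-generation square distances shrink by 4; across two squares
    they are at least 1/2. The 2 is added in both cases to keep the sum uniform.\<close>
  have pair: "1 / l1_dist (?\<phi> c p) (?\<phi> d q) \<le> (if c = d then 4 / l1_dist p q else 0) + 2"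
    if "c \<in> ?C" "d \<in> ?C" "p \<in> ?P" "q \<in> ?P" for c d p q
  proof (cases "c = d")
    case False
    then show ?thesis
      using l1_dist_distinct_corners[OF that(1,2) False that(3,4)] by (simp add: field_simps)
  qed (use l1_dist_translate_scale[of c p q] in \<open>simp only: if_True, simp\<close>)
  have "(\<Sum>p\<in>cantor_corners (Suc n). \<Sum>q\<in>cantor_corners (Suc n). 1 / l1_dist p q)
      = (\<Sum>c\<in>?C. \<Sum>p\<in>?P. \<Sum>d\<in>?C. \<Sum>q\<in>?P. 1 / l1_dist (?\<phi> c p) (?\<phi> d q))"
    by (simp only: reindex)
  also have "\<dots> \<le> (\<Sum>c\<in>?C. \<Sum>p\<in>?P. \<Sum>d\<in>?C. \<Sum>q\<in>?P. (if c = d then 4 / l1_dist p q else 0) + 2)"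
    by (intro sum_mono pair)
  also have "\<dots> = (\<Sum>c\<in>?C. \<Sum>p\<in>?P. \<Sum>d\<in>?C. (if c = d then 4 * (\<Sum>q\<in>?P. 1 / l1_dist p q) else 0) + 2 * 4 ^ n)"
    by (intro sum.cong refl) (simp add: sum.distrib card_cantor_corners sum_distrib_left)
  also have "\<dots> = (\<Sum>c\<in>?C. \<Sum>p\<in>?P. 4 * (\<Sum>q\<in>?P. 1 / l1_dist p q) + 8 * 4 ^ n)"
  proof (intro sum.cong refl)
    fix c p assume "c \<in> ?C"
    then show "(\<Sum>d\<in>?C. (if c = d then 4 * (\<Sum>q\<in>?P. 1 / l1_dist p q) else 0) + 2 * 4 ^ n)
       = 4 * (\<Sum>q\<in>?P. 1 / l1_dist p q) + 8 * 4 ^ n"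
      by (simp add: sum.distrib sum.delta card_corner_offsets)
  qed
  also have "\<dots> = 16 * (\<Sum>p\<in>?P. \<Sum>q\<in>?P. 1 / l1_dist p q) + 32 * 4 ^ n * 4 ^ n"
    by (simp add: sum.distrib card_corner_offsets card_cantor_corners sum_distrib_left[symmetric])
  also have "\<dots> = 16 * (\<Sum>p\<in>?P. \<Sum>q\<in>?P. 1 / l1_dist p q) + 32 * 16 ^ n"
    by (simp add: power_mult_distrib[symmetric])
  \<comment> \<open>Each generation multiplies the energy by 16 and adds
    \<open>2 * 16 ^ Suc n\<close>, whence the linear factor \<open>n\<close> after normalization by
    \<open>16 ^ n\<close>.\<close>
  also have "\<dots> \<le> 16 * (2 * real n * 16 ^ n) + 32 * 16 ^ n"
    using Suc by simp
  finally show ?case by (simp add: algebra_simps)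
qed

subsection \<open>Measurability of the curve projections\<close>

text \<open>A piece parametrized by an open or half-open interval need not be compact; this
  exhaustion makes it a countable union of compact curves.\<close>

lemma real_interval_sigma_compact:
  fixes I :: "real set"
  assumes "is_interval I"
  obtains F where "countable F" "\<And>K. K \<in> F \<Longrightarrow> compact K" "I = \<Union>F"
proof -
  \<comment> \<open>Rational endpoints miss only a least or greatest element of \<open>I\<close>, so
    these are added when they exist.\<close>
  define X where "X = \<rat> \<union> {x\<in>I. \<forall>y\<in>I. x \<le> y} \<union> {x\<in>I. \<forall>y\<in>I. y \<le> x}"
  define F where "F = (\<lambda>(u, v). {u..v}) ` ((X \<inter> I) \<times> (X \<inter> I))"
  have "{x\<in>I. \<forall>y\<in>I. x \<le> y} \<subseteq> {Inf I}" "{x\<in>I. \<forall>y\<in>I. y \<le> x} \<subseteq> {Sup I}"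
    by (auto intro: cInf_eq_minimum[symmetric] cSup_eq_maximum[symmetric])
  then have "countable {x\<in>I. \<forall>y\<in>I. x \<le> y}" "countable {x\<in>I. \<forall>y\<in>I. y \<le> x}"
    by (meson countable_finite countable_subset finite.emptyI finite.insertI)+
  then have "countable X" using countable_rat unfolding X_def by auto
  then have "countable F" unfolding F_def by (auto intro!: countable_image countable_SIGMA countable_Int1)
  moreover have "compact K" if "K \<in> F" for K using that by (auto simp: F_def)
  moreover have "I = \<Union>F"
  proof (intro equalityI subsetI)
    fix x assume x: "x \<in> I"
    have "\<exists>u\<in>X \<inter> I. u \<le> x"
    proof (cases "\<forall>y\<in>I. x \<le> y")
      case False
      then obtain y where y: "y \<in> I" "y < x" by auto
      then obtain r where "r \<in> \<rat>" "y < r" "r < x" using Rats_dense_in_real by blast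
      then have "r \<in> X \<inter> I" "r \<le> x"
        using mem_is_interval_1_I[OF assms y(1) x, of r] unfolding X_def by auto
      then show ?thesis by blast
    qed (use x in \<open>auto simp: X_def\<close>)
    moreover have "\<exists>v\<in>X \<inter> I. x \<le> v"
    proof (cases "\<forall>y\<in>I. y \<le> x")
      case False
      then obtain y where y: "y \<in> I" "x < y" by auto
      then obtain r where "r \<in> \<rat>" "x < r" "r < y" using Rats_dense_in_real by blast
      then have "r \<in> X \<inter> I" "x \<le> r"
        using mem_is_interval_1_I[OF assms x y(1), of r] unfolding X_def by auto
      then show ?thesis by blast
    qed (use x in \<open>auto simp: X_def\<close>)
    ultimately show "x \<in> \<Union>F" unfolding F_def by fastforce
  next
    fix x assume "x \<in> \<Union>F"
    then show "x \<in> I" using mem_is_interval_1_I[OF assms] unfolding F_def by auto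
  qed
  ultimately show thesis using that by blast
qed

lemma compact_four_corner_cantor: "compact (four_corner_cantor n)"
  unfolding four_corner_cantor_def by (intro compact_UN) (auto intro: compact_Times)

text \<open>The projection is a vertical slice of the Minkowski sum of \<open>S\<close> and
  \<open>K\<close>, which is compact.\<close>

lemma curve_proj_compact_measurable:
  assumes "compact K" "compact S"
  shows "curve_proj K \<alpha> S \<in> sets borel"
proof -
  have "curve_proj K \<alpha> S = Pair \<alpha> -` {x + y | x y. x \<in> S \<and> y \<in> K}"
    unfolding curve_proj_def curve_proj_point_def by blast
  moreover have "closed {x + y | x y. x \<in> S \<and> y \<in> K}"
    using compact_sums[OF assms(2,1)] by (rule compact_imp_closed)
  then have "closed (Pair \<alpha> -` {x + y | x y. x \<in> S \<and> y \<in> K})"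
    by (intro continuous_closed_vimage) (auto intro: continuous_intros)
  ultimately show ?thesis by simp
qed

lemma curve_proj_bi_lipschitz_tangent_curve_measurable:
  assumes "bi_lipschitz_tangent_curve C" "compact S"
  shows "curve_proj C \<alpha> S \<in> sets borel"
proof -
  obtain I \<gamma> T where I: "is_interval I"
    and \<gamma>': "\<And>s. s \<in> I \<Longrightarrow> (\<gamma> has_vector_derivative T s) (at s within I)" and C: "C = \<gamma> ` I"
    using assms(1) unfolding bi_lipschitz_tangent_curve_def by blast
  have cont: "continuous_on I \<gamma>"
    using \<gamma>' has_vector_derivative_continuous continuous_on_eq_continuous_within by blast
  obtain F where F: "countable F" "\<And>K. K \<in> F \<Longrightarrow> compact K" "I = \<Union>F"
    using real_interval_sigma_compact[OF I] by blast
  have "curve_proj C \<alpha> S = (\<Union>K\<in>F. curve_proj (\<gamma> ` K) \<alpha> S)"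
    unfolding C F(3) curve_proj_def curve_proj_point_def by blast
  moreover have "curve_proj (\<gamma> ` K) \<alpha> S \<in> sets borel" if "K \<in> F" for K
  proof (rule curve_proj_compact_measurable[OF _ assms(2)])
    have "continuous_on K \<gamma>" using cont by (rule continuous_on_subset) (use F(3) that in auto)
    then show "compact (\<gamma> ` K)" using F(2)[OF that] by (rule compact_continuous_image)
  qed
  ultimately show ?thesis using F(1) by (auto intro: sets.countable_UN')
qed

text \<open>Since \<open>emeasure\<close> is monotone only into measurable sets, this is what allows
  a slice to be bounded below by segments inside it.\<close>

lemma curve_proj_measurable:
  assumes "piecewise_bi_lipschitz_tangent_curve \<Gamma>" "compact S"
  shows "curve_proj \<Gamma> \<alpha> S \<in> sets borel"
proof -
  obtain \<C> where \<C>: "countable \<C>" "\<And>C. C \<in> \<C> \<Longrightarrow> bi_lipschitz_tangent_curve C" "\<Gamma> = \<Union>\<C>"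
    using assms(1) unfolding piecewise_bi_lipschitz_tangent_curve_def by blast
  have "curve_proj \<Gamma> \<alpha> S = (\<Union>C\<in>\<C>. curve_proj C \<alpha> S)"
    unfolding \<C>(3) curve_proj_def curve_proj_point_def by blast
  then show ?thesis
    using \<C>(1,2) curve_proj_bi_lipschitz_tangent_curve_measurable[OF _ assms(2)]
    by (auto intro!: sets.countable_UN')
qed

subsection \<open>Graphs contained in the curve\<close>

text \<open>The condition \<open>expand\<close> is a form of nonvanishing curvature that needs no
  second derivative; a bound \<open>c\<close> from below on the modulus of a second derivative would
  imply it.\<close>

locale slope_expanding =
  fixes f f' :: "real \<Rightarrow> real" and a b c M :: real
  assumes ab: "a < b" and c: "0 < c"
    and deriv: "\<And>x. x \<in> {a..b} \<Longrightarrow> (f has_real_derivative f' x) (at x)"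
    and bound: "\<And>x. x \<in> {a..b} \<Longrightarrow> \<bar>f' x\<bar> \<le> M"
    and expand: "\<And>x y. \<lbrakk>x \<in> {a..b}; y \<in> {a..b}\<rbrakk> \<Longrightarrow> c * \<bar>x - y\<bar> \<le> \<bar>f' x - f' y\<bar>"

text \<open>Let theta be the angle between the vectors, so that \<open>D\<close> is cos theta and
  \<open>X\<close> is sin theta up to sign. By \<open>near\<close>, cos theta is nonnegative, so the
  squared chord 2 (1 - cos theta) is at most 2 sin^2 theta; the slopes differ by
  \<open>X / (p * p')\<close>, where \<open>p * p'\<close> has modulus at most 1. Opposite vectors,
  which have equal slopes, are excluded by \<open>near\<close>.\<close>

lemma unit_vector_dist_le_slope_diff:
  fixes p q p' q' :: real
  assumes unit: "p\<^sup>2 + q\<^sup>2 = 1" "p'\<^sup>2 + q'\<^sup>2 = 1"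
    and near: "(p - p')\<^sup>2 + (q - q')\<^sup>2 \<le> 2"
    and nz: "p \<noteq> 0" "p' \<noteq> 0"
  shows "(p - p')\<^sup>2 + (q - q')\<^sup>2 \<le> 2 * (q / p - q' / p')\<^sup>2"
proof -
  define D where "D = p * p' + q * q'"
  define X where "X = q * p' - q' * p"
  have dist: "(p - p')\<^sup>2 + (q - q')\<^sup>2 = 2 - 2 * D"
    using unit unfolding D_def by (simp add: power2_eq_square algebra_simps)
  have DX: "D\<^sup>2 + X\<^sup>2 = 1"
  proof -
    have "D\<^sup>2 + X\<^sup>2 = (p\<^sup>2 + q\<^sup>2) * (p'\<^sup>2 + q'\<^sup>2)"
      unfolding D_def X_def by algebra
    then show ?thesis using unit by simp
  qed
  have "0 \<le> D" using near dist by simp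
  moreover have "D \<le> 1" using dist by (smt (verit) zero_le_power2)
  ultimately have "D\<^sup>2 \<le> D" by (simp add: power2_eq_square mult_left_le_one_le)
  then have "1 - D \<le> X\<^sup>2" using DX by simp
  also have "X\<^sup>2 \<le> (X / (p * p'))\<^sup>2"
  proof -
    have "p\<^sup>2 \<le> 1" "p'\<^sup>2 \<le> 1" using unit by (smt (verit) zero_le_power2)+
    then have "(p * p')\<^sup>2 \<le> 1" by (simp add: power_mult_distrib mult_le_one)
    then show ?thesis using nz
      by (simp add: power_divide divide_simps mult_right_le_one_le)
  qed
  also have "X / (p * p') = q / p - q' / p'" using nz unfolding X_def by (simp add: field_simps)
  finally show ?thesis using dist by simp
qed

text \<open>A short arc away from vertical tangents is reparametrized by its first coordinate.
  Expansion passes from the tangent to the slope by the chord estimate, and from arclength to the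
  first coordinate by unit speed.\<close>

lemma bi_lipschitz_tangent_curve_contains_graph:
  assumes "bi_lipschitz_tangent_curve C"
  obtains f f' a b c M where "slope_expanding f f' a b c M" "(\<lambda>x. (x, f x)) ` {a..b} \<subseteq> C"
proof -
  obtain I \<gamma> T a0 b0 L where I: "is_interval I" "a0 \<in> I" "b0 \<in> I" "a0 < b0"
    and \<gamma>': "\<And>s. s \<in> I \<Longrightarrow> (\<gamma> has_vector_derivative T s) (at s within I)"
    and T: "continuous_on I T" "\<And>s. s \<in> I \<Longrightarrow> norm (T s) = 1"
    and L: "0 < L" "\<And>s t. \<lbrakk>s \<in> I; t \<in> I\<rbrakk> \<Longrightarrow> dist s t / L \<le> dist (T s) (T t)"
    and C: "C = \<gamma> ` I"
    using assms unfolding bi_lipschitz_tangent_curve_def bi_lipschitz_on_def by blast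
  have sub: "{a0<..<b0} \<subseteq> I"
    using I mem_is_interval_1_I by (metis greaterThanLessThan_iff less_imp_le subsetI)
  have \<gamma>_deriv: "(\<gamma> has_vector_derivative T s) (at s)" if "s \<in> {a0<..<b0}" for s
    using \<gamma>' sub that by (metis at_within_open has_vector_derivative_within_subset open_greaterThanLessThan subsetD)
  have unit: "(fst (T s))\<^sup>2 + (snd (T s))\<^sup>2 = 1" if "s \<in> I" for s
    using T(2)[OF that] by (simp add: norm_prod_def)
  have T_inj: "s = t" if "s \<in> I" "t \<in> I" "T s = T t" for s t
  proof -
    have "dist s t / L \<le> 0" using L(2)[OF that(1,2)] that(3) by simp
    then show ?thesis using L(1) by (simp add: divide_le_0_iff)
  qed
  have "\<exists>s\<in>{a0<..<b0}. fst (T s) \<noteq> 0"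
  proof (rule ccontr)
    assume "\<not> ?thesis"
    then have vert: "T s \<in> {(0, 1), (0, -1)}" if "s \<in> {a0<..<b0}" for s
      using unit[of s] sub that by (cases "T s") (force simp: power2_eq_1_iff)
    have "T ` {a0<..<b0} \<subseteq> {(0, 1), (0, -1)}" using vert by blast
    then have "finite (T ` {a0<..<b0})" by (rule finite_subset) simp
    moreover have "inj_on T {a0<..<b0}" using T_inj sub by (meson inj_onI subsetD)
    ultimately have "finite {a0<..<b0}" by (rule finite_imageD)
    then show False using infinite_Ioo[OF I(4)] by contradiction
  qed
  then obtain s0 where s0: "s0 \<in> {a0<..<b0}" "fst (T s0) \<noteq> 0" by blast
  define k where "k = \<bar>fst (T s0)\<bar> / 2"
  have k: "0 < k" using s0 by (simp add: k_def)
  have "isCont T s0"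
    using T(1) sub s0(1) by (meson continuous_on_eq_continuous_at continuous_on_subset open_greaterThanLessThan)
  \<comment> \<open>The bound \<open>k\<close> keeps the first coordinate of the tangent at least
    \<open>k\<close> in modulus; the bound 1/2 keeps any two tangents within distance 1, as the
    chord estimate requires.\<close>
  then obtain e where e: "0 < e" "\<And>s. dist s s0 < e \<Longrightarrow> dist (T s) (T s0) < min k (1/2)"
    unfolding continuous_at_eps_delta using k by (metis half_gt_zero_iff min_less_iff_conj zero_less_one)
  define \<eta> where "\<eta> = min (e / 2) (min ((s0 - a0) / 2) ((b0 - s0) / 2))"
  have \<eta>: "0 < \<eta>" using e(1) s0 by (simp add: \<eta>_def)
  define J where "J = {s0 - \<eta>..s0 + \<eta>}"
  have J: "J \<subseteq> {a0<..<b0}"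
  proof -
    have "\<eta> \<le> min ((s0 - a0) / 2) ((b0 - s0) / 2)" unfolding \<eta>_def by (rule min.cobounded2)
    then have "2 * \<eta> \<le> s0 - a0" "2 * \<eta> \<le> b0 - s0" by (simp_all add: min_def split: if_splits)
    then show ?thesis using s0(1) \<eta> unfolding J_def by auto
  qed
  have JI: "s \<in> I" if "s \<in> J" for s using that J sub by blast
  have near: "dist (T s) (T s0) < min k (1/2)" if "s \<in> J" for s
  proof (rule e(2))
    have "\<eta> \<le> e / 2" unfolding \<eta>_def by simp
    moreover have "\<bar>s - s0\<bar> \<le> \<eta>" using that unfolding J_def by auto
    ultimately show "dist s s0 < e" using e(1) unfolding dist_real_def by linarith
  qed
  have fstT: "k \<le> \<bar>fst (T s)\<bar>" if "s \<in> J" for s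
  proof -
    have "\<bar>fst (T s) - fst (T s0)\<bar> \<le> dist (T s) (T s0)"
      using dist_fst_le[of "T s" "T s0"] by (simp add: dist_real_def)
    then show ?thesis using near[OF that] unfolding k_def by (simp add: abs_if split: if_splits)
  qed
  define m where "m s = snd (T s) / fst (T s)" for s
  have m_expand: "\<bar>s - t\<bar> \<le> 2 * L * \<bar>m s - m t\<bar>" if "s \<in> J" "t \<in> J" for s t
  proof -
    have dist_sq: "(dist (T s) (T t))\<^sup>2 = (fst (T s) - fst (T t))\<^sup>2 + (snd (T s) - snd (T t))\<^sup>2"
      by (simp add: dist_prod_def dist_real_def)
    have "dist (T s) (T t) \<le> 1"
      using near[OF that(1)] near[OF that(2)] dist_triangle2[of "T s" "T t" "T s0"] by simp
    then have "(dist (T s) (T t))\<^sup>2 \<le> 2" using power_le_one[of "dist (T s) (T t)" 2] by simp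
    then have "(dist (T s) (T t))\<^sup>2 \<le> 2 * (m s - m t)\<^sup>2"
      unfolding m_def dist_sq
      using unit_vector_dist_le_slope_diff[OF unit[OF JI[OF that(1)]] unit[OF JI[OF that(2)]]]
        fstT[OF that(1)] fstT[OF that(2)] k by force
    \<comment> \<open>The factor sqrt 2 is rounded up to 2.\<close>
    also have "\<dots> \<le> (2 * \<bar>m s - m t\<bar>)\<^sup>2" by (simp add: power2_eq_square)
    finally have "dist (T s) (T t) \<le> 2 * \<bar>m s - m t\<bar>" by (rule power2_le_imp_le) simp
    then have "\<bar>s - t\<bar> / L \<le> 2 * \<bar>m s - m t\<bar>"
      using L(2)[OF JI[OF that(1)] JI[OF that(2)]] by (simp add: dist_real_def)
    then show ?thesis using L(1) by (simp add: field_simps)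
  qed
  define \<phi> where "\<phi> = fst \<circ> \<gamma>"
  define \<psi> where "\<psi> = snd \<circ> \<gamma>"
  have \<phi>: "(\<phi> has_real_derivative fst (T s)) (at s)"
    and \<psi>: "(\<psi> has_real_derivative snd (T s)) (at s)" if "s \<in> J" for s
  proof -
    have \<gamma>s: "(\<gamma> has_derivative (\<lambda>h. h *\<^sub>R T s)) (at s)"
      using \<gamma>_deriv J that by (auto simp: has_vector_derivative_def)
    show "(\<phi> has_real_derivative fst (T s)) (at s)" "(\<psi> has_real_derivative snd (T s)) (at s)"
      using has_derivative_fst[OF \<gamma>s] has_derivative_snd[OF \<gamma>s]
      by (simp_all add: \<phi>_def \<psi>_def o_def has_field_derivative_def mult.commute[of _ "_ :: real"]
          mult_commute_abs)
  qed
  have MVT: "\<exists>z\<in>J. \<phi> t - \<phi> s = (t - s) * fst (T z)" if "s \<in> J" "t \<in> J" "s < t" for s t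
  proof -
    have "\<exists>z. s < z \<and> z < t \<and> \<phi> t - \<phi> s = (t - s) * fst (T z)"
      using that \<phi> unfolding J_def by (intro MVT2) auto
    then show ?thesis using that unfolding J_def by fastforce
  qed
  have \<phi>_inj: "inj_on \<phi> J"
  proof (rule linorder_inj_onI)
    fix s t assume st: "s < t" "s \<in> J" "t \<in> J"
    then obtain z where "z \<in> J" "\<phi> t - \<phi> s = (t - s) * fst (T z)" using MVT by blast
    then show "\<phi> s \<noteq> \<phi> t" using fstT[of z] k st by auto
  qed auto
  have \<phi>_lip1: "\<bar>\<phi> t - \<phi> s\<bar> \<le> t - s" if st: "s \<in> J" "t \<in> J" "s < t" for s t
  proof -
    obtain z where z: "z \<in> J" "\<phi> t - \<phi> s = (t - s) * fst (T z)" using MVT[OF st] by blast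
    have "\<bar>fst (T z)\<bar> \<le> 1" using T(2)[OF JI[OF z(1)]] norm_fst_le[of "fst (T z)" "snd (T z)"] by simp
    then show ?thesis using z(2) st(3) by (simp add: abs_mult mult_left_le)
  qed
  \<comment> \<open>This turns expansion of the slope in arclength into expansion in the first
    coordinate.\<close>
  have \<phi>_lip: "\<bar>\<phi> s - \<phi> t\<bar> \<le> \<bar>s - t\<bar>" if "s \<in> J" "t \<in> J" for s t
    using \<phi>_lip1[of s t] \<phi>_lip1[of t s] that by (cases s t rule: linorder_cases) auto
  have \<phi>_cont: "continuous_on J \<phi>"
    using \<phi> by (meson DERIV_isCont continuous_at_imp_continuous_on)
  obtain A B where AB: "\<phi> ` J = {A..B}"
    using continuous_image_closed_interval[of "s0 - \<eta>" "s0 + \<eta>" \<phi>] \<eta> \<phi>_cont unfolding J_def by auto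
  have "A < B"
  proof -
    have "\<phi> (s0 - \<eta>) \<noteq> \<phi> (s0 + \<eta>)" using \<phi>_inj \<eta> unfolding J_def by (auto dest: inj_onD)
    moreover have "\<phi> (s0 - \<eta>) \<in> {A..B}" "\<phi> (s0 + \<eta>) \<in> {A..B}"
      using \<eta> unfolding AB[symmetric] J_def by auto
    ultimately show ?thesis by auto
  qed
  define g where "g = inv_into J \<phi>"
  have g: "g x \<in> J" "\<phi> (g x) = x" if "x \<in> {A..B}" for x
    using that unfolding g_def AB[symmetric] by (auto intro: inv_into_into f_inv_into_f)
  have "continuous_on (\<phi> ` J) g"
    using \<phi>_cont \<phi>_inj unfolding g_def by (intro continuous_on_inv) (auto simp: J_def)
  then have g_cont: "isCont g x" if "x \<in> {A<..<B}" for x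
    using that unfolding AB
    by (meson continuous_on_eq_continuous_at continuous_on_subset greaterThanLessThan_subseteq_atLeastAtMost_iff open_greaterThanLessThan order_refl)
  have g_deriv: "(g has_real_derivative inverse (fst (T (g x)))) (at x)" if "x \<in> {A<..<B}" for x
    using that g[of x] g g_cont fstT[of "g x"] k \<phi>[of "g x"]
    by (intro DERIV_inverse_function[where f = \<phi> and a = A and b = B]) auto
  \<comment> \<open>The middle third of \<open>{A..B}\<close> keeps \<open>a\<close> and
    \<open>b\<close> interior, where the inverse \<open>g\<close> has a two-sided
    derivative.\<close>
  define a where "a = (2 * A + B) / 3"
  define b where "b = (A + 2 * B) / 3"
  have ab: "{a..b} \<subseteq> {A<..<B}" "a < b" using \<open>A < B\<close> unfolding a_def b_def by auto
  have abJ: "g x \<in> J" "\<phi> (g x) = x" if "x \<in> {a..b}" for x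
    using that ab(1) g[of x] by fastforce+
  have "slope_expanding (\<psi> \<circ> g) (m \<circ> g) a b (1 / (2 * L)) (1 / k)"
  proof
    show "a < b" "0 < 1 / (2 * L)" using ab L by auto
    show "((\<psi> \<circ> g) has_real_derivative (m \<circ> g) x) (at x)" if "x \<in> {a..b}" for x
      using DERIV_chain[OF \<psi>[OF abJ(1)[OF that]] g_deriv[of x]] ab(1) that
      by (auto simp: m_def divide_inverse)
    show "\<bar>(m \<circ> g) x\<bar> \<le> 1 / k" if "x \<in> {a..b}" for x
    proof -
      have "\<bar>snd (T (g x))\<bar> \<le> 1"
        using T(2)[OF JI[OF abJ(1)[OF that]]] norm_snd_le[of "snd (T (g x))" "fst (T (g x))"] by simp
      then show ?thesis
        using fstT[OF abJ(1)[OF that]] k unfolding m_def o_apply abs_divide by (intro frac_le) auto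
    qed
    show "1 / (2 * L) * \<bar>x - y\<bar> \<le> \<bar>(m \<circ> g) x - (m \<circ> g) y\<bar>" if xy: "x \<in> {a..b}" "y \<in> {a..b}" for x y
      using m_expand[OF abJ(1)[OF xy(1)] abJ(1)[OF xy(2)]] \<phi>_lip[OF abJ(1)[OF xy(1)] abJ(1)[OF xy(2)]]
        abJ(2)[OF xy(1)] abJ(2)[OF xy(2)] L(1) by (simp add: field_simps)
  qed
  moreover have "(x, (\<psi> \<circ> g) x) = \<gamma> (g x)" if "x \<in> {a..b}" for x
    using abJ(2)[OF that] unfolding \<phi>_def \<psi>_def by (simp add: prod_eq_iff)
  then have "(\<lambda>x. (x, (\<psi> \<circ> g) x)) ` {a..b} \<subseteq> C"
    using abJ(1) JI unfolding C by auto
  ultimately show thesis by (rule that)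
qed

subsection \<open>The second moment bound\<close>

text \<open>This is Cauchy-Schwarz for the overlap count with a free parameter \<open>t\<close>
  instead of a quotient. Being linear in both moments, it can be applied on every slice with the
  same \<open>t\<close> and then integrated.\<close>

lemma measure_UN_ge_second_moment:
  assumes "finite P" and E: "\<And>p. p \<in> P \<Longrightarrow> E p \<in> fmeasurable M"
  shows "2 * t * (\<Sum>p\<in>P. measure M (E p)) - t\<^sup>2 * (\<Sum>p\<in>P. \<Sum>q\<in>P. measure M (E p \<inter> E q))
           \<le> measure M (\<Union>p\<in>P. E p)"
proof -
  let ?N = "\<lambda>x. \<Sum>p\<in>P. indicat_real (E p) x"
  have int1: "integrable M (indicat_real (E p))" if "p \<in> P" for p
    using E[OF that] by (simp add: integrable_indicator_iff fmeasurable_def)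
  have int2: "integrable M (indicat_real (E p \<inter> E q))" if "p \<in> P" "q \<in> P" for p q
    using fmeasurable_Int_fmeasurable[OF E[OF that(1)], of "E q"] E[OF that(2)] that
    by (simp add: integrable_indicator_iff fmeasurable_def)
  have U: "(\<Union>p\<in>P. E p) \<in> fmeasurable M" using assms by (intro fmeasurable.finite_UN) auto
  have sq: "(?N x)\<^sup>2 = (\<Sum>p\<in>P. \<Sum>q\<in>P. indicat_real (E p \<inter> E q) x)" for x
    by (simp add: power2_eq_square sum_product indicator_inter_arith)
  have "2 * t * (\<Sum>p\<in>P. measure M (E p)) - t\<^sup>2 * (\<Sum>p\<in>P. \<Sum>q\<in>P. measure M (E p \<inter> E q))
      = (\<integral>x. 2 * t * ?N x - t\<^sup>2 * (\<Sum>p\<in>P. \<Sum>q\<in>P. indicat_real (E p \<inter> E q) x) \<partial>M)"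
    using int1 int2 E
    by (simp add: Bochner_Integration.integral_diff Bochner_Integration.integral_sum
        Bochner_Integration.integrable_sum sets.Int_space_eq2 fmeasurable_def sets.Int)
  also have "\<dots> \<le> (\<integral>x. indicat_real (\<Union>p\<in>P. E p) x \<partial>M)"
  proof (rule integral_mono)
    fix x
    show "2 * t * ?N x - t\<^sup>2 * (\<Sum>p\<in>P. \<Sum>q\<in>P. indicat_real (E p \<inter> E q) x)
        \<le> indicat_real (\<Union>p\<in>P. E p) x"
    proof (cases "x \<in> (\<Union>p\<in>P. E p)")
      case True
      have "0 \<le> (1 - t * ?N x)\<^sup>2" by simp
      then show ?thesis using True unfolding sq[symmetric]
        by (simp add: power2_eq_square algebra_simps)
    next
      case False
      then have "?N x = 0" by (intro sum.neutral) auto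
      then show ?thesis unfolding sq[symmetric] by simp
    qed
  next
    show "integrable M (\<lambda>x. 2 * t * ?N x - t\<^sup>2 * (\<Sum>p\<in>P. \<Sum>q\<in>P. indicat_real (E p \<inter> E q) x))"
      using int1 int2 by (intro Bochner_Integration.integrable_diff integrable_mult_right Bochner_Integration.integrable_sum) auto
  qed (use U in \<open>simp add: integrable_indicator_iff fmeasurable_def\<close>)
  also have "\<dots> = measure M (\<Union>p\<in>P. E p)"
    using U by (simp add: fmeasurable_def)
  finally show ?thesis .
qed

lemma curve_proj_ge_graph:
  fixes f :: "real \<Rightarrow> real"
  assumes graph: "(\<lambda>x. (x, f x)) ` {a..b} \<subseteq> \<Gamma>" and p: "p \<in> cantor_corners n"
    and x: "\<alpha> - fst p \<in> {a..b}"
  shows "{snd p + f (\<alpha> - fst p)..snd p + f (\<alpha> - fst p) + 1 / 4 ^ n}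
           \<subseteq> curve_proj \<Gamma> \<alpha> (four_corner_cantor n)"
proof
  fix \<beta> assume \<beta>: "\<beta> \<in> {snd p + f (\<alpha> - fst p)..snd p + f (\<alpha> - fst p) + 1 / 4 ^ n}"
  \<comment> \<open>A point of the left edge of the square at \<open>p\<close>, at the height for
    which its sum with the graph point is \<open>(\<alpha>, \<beta>)\<close>.\<close>
  define z where "z = (fst p, \<beta> - f (\<alpha> - fst p))"
  have "z \<in> {fst p..fst p + 1 / 4 ^ n} \<times> {snd p..snd p + 1 / 4 ^ n}"
    using \<beta> unfolding z_def by auto
  then have "z \<in> four_corner_cantor n" using p unfolding four_corner_cantor_def by force
  moreover have "(\<alpha>, \<beta>) = z + (\<alpha> - fst p, f (\<alpha> - fst p))" unfolding z_def by simp
  moreover have "(\<alpha> - fst p, f (\<alpha> - fst p)) \<in> \<Gamma>" using graph x by blast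
  ultimately show "\<beta> \<in> curve_proj \<Gamma> \<alpha> (four_corner_cantor n)"
    unfolding curve_proj_def curve_proj_point_def by blast
qed

section \<open>Transversality and overlaps of translated graphs\<close>

context slope_expanding
begin

lemma M_nonneg: "0 \<le> M"
  using bound[of a] ab by force

lemma lipschitz:
  assumes "x \<in> {a..b}" "y \<in> {a..b}"
  shows "\<bar>f x - f y\<bar> \<le> M * \<bar>x - y\<bar>"
  using field_differentiable_bound[of "{a..b}" f f' M x y] deriv bound assms
  by (auto intro: has_field_derivative_at_within)

text \<open>The increment \<open>f (t + u) - f t\<close> has derivative
  \<open>f' (t + u) - f' t\<close> in \<open>t\<close>, of modulus at least
  \<open>c * \<bar>u\<bar>\<close>; the mean value theorem does the rest.\<close>

lemma increment_expanding:
  assumes "{x, y, x + u, y + u} \<subseteq> {a..b}"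
  shows "c * \<bar>u\<bar> * \<bar>x - y\<bar> \<le> \<bar>(f (x + u) - f x) - (f (y + u) - f y)\<bar>"
proof -
  have less: "c * \<bar>u\<bar> * \<bar>x - y\<bar> \<le> \<bar>(f (x + u) - f x) - (f (y + u) - f y)\<bar>"
    if xy: "x < y" and sub: "{x, y, x + u, y + u} \<subseteq> {a..b}" for x y
  proof -
    have "((\<lambda>t. f (t + u) - f t) has_real_derivative f' (t + u) - f' t) (at t)"
      if "x \<le> t" "t \<le> y" for t
    proof (rule DERIV_diff)
      show "((\<lambda>t. f (t + u)) has_real_derivative f' (t + u)) (at t)"
        using deriv[of "t + u"] that sub by (simp add: DERIV_shift)
      show "(f has_real_derivative f' t) (at t)" using deriv[of t] that sub by simp
    qed
    then obtain t where t: "x < t" "t < y"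
      and eq: "(f (y + u) - f y) - (f (x + u) - f x) = (y - x) * (f' (t + u) - f' t)"
      using MVT2[OF xy, of "\<lambda>t. f (t + u) - f t" "\<lambda>t. f' (t + u) - f' t"] by blast
    have "c * \<bar>u\<bar> * \<bar>x - y\<bar> \<le> \<bar>f' (t + u) - f' t\<bar> * \<bar>x - y\<bar>"
      using expand[of "t + u" t] t sub by (intro mult_right_mono) auto
    also have "\<dots> = \<bar>(f (x + u) - f x) - (f (y + u) - f y)\<bar>"
      using arg_cong[OF eq, of abs]
      by (simp only: abs_mult abs_minus_commute[of y x] mult.commute abs_minus_commute[of "f (y + u) - f y"])
    finally show ?thesis .
  qed
  show ?thesis
    using less[of x y] less[of y x] assms
    by (cases x y rule: linorder_cases) (auto simp: abs_minus_commute)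
qed

text \<open>These are the \<alpha> at which the closed vertical segments of length \<delta>
  contributed by \<open>p\<close> and \<open>q\<close> meet.\<close>

definition overlap :: "real \<Rightarrow> real \<times> real \<Rightarrow> real \<times> real \<Rightarrow> real set" where
  "overlap \<delta> p q = {\<alpha>. \<alpha> - fst p \<in> {a..b} \<and> \<alpha> - fst q \<in> {a..b} \<and>
     \<bar>(snd p + f (\<alpha> - fst p)) - (snd q + f (\<alpha> - fst q))\<bar> \<le> \<delta>}"

text \<open>
  The Lipschitz bound confines overlaps to pairs of squares whose horizontal displacement is
  comparable to their distance; there the expanding slope makes the graphs cross transversally.
\<close>

lemma overlap_dist_le:
  assumes \<delta>: "0 < \<delta>" "2 * \<delta> \<le> l1_dist p q"
    and \<alpha>: "\<alpha> \<in> overlap \<delta> p q" and \<beta>: "\<beta> \<in> overlap \<delta> p q"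
  shows "\<bar>\<alpha> - \<beta>\<bar> \<le> 4 * (M + 1) / c * \<delta> / l1_dist p q"
proof -
  define u where "u = fst p - fst q"
  define d where "d = l1_dist p q"
  have d: "0 < d" using \<delta> unfolding d_def by simp
  have q: "\<alpha> - fst q = (\<alpha> - fst p) + u" "\<beta> - fst q = (\<beta> - fst p) + u" unfolding u_def by simp_all
  have "\<bar>snd p - snd q\<bar> \<le> \<bar>f (\<alpha> - fst q) - f (\<alpha> - fst p)\<bar> + \<delta>"
    using \<alpha> unfolding overlap_def by auto
  moreover have "\<bar>f (\<alpha> - fst q) - f (\<alpha> - fst p)\<bar> \<le> M * \<bar>u\<bar>"
    using lipschitz[of "\<alpha> - fst q" "\<alpha> - fst p"] \<alpha> unfolding overlap_def u_def by simp
  ultimately have "\<bar>snd p - snd q\<bar> \<le> M * \<bar>u\<bar> + \<delta>" by (meson add_right_mono order_trans)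
  also have "\<dots> \<le> M * \<bar>u\<bar> + d / 2" using \<delta>(2) by (simp add: d_def)
  finally have "\<bar>u\<bar> + \<bar>snd p - snd q\<bar> \<le> \<bar>u\<bar> + (M * \<bar>u\<bar> + d / 2)" by (rule add_left_mono)
  then have "d \<le> \<bar>u\<bar> + (M * \<bar>u\<bar> + d / 2)" unfolding d_def l1_dist_def u_def .
  \<comment> \<open>The term \<open>d / 2\<close> is absorbed on the left, which is why the
    separation had to be at least \<open>2 * \<delta>\<close>.\<close>
  then have u: "d \<le> 2 * (M + 1) * \<bar>u\<bar>" by (simp add: algebra_simps)
  have "d * (c * \<bar>\<alpha> - \<beta>\<bar>) \<le> 2 * (M + 1) * \<bar>u\<bar> * (c * \<bar>\<alpha> - \<beta>\<bar>)"
    using u c by (intro mult_right_mono) auto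
  also have "\<dots> = 2 * (M + 1) * (c * \<bar>u\<bar> * \<bar>(\<alpha> - fst p) - (\<beta> - fst p)\<bar>)" by simp
  also have "c * \<bar>u\<bar> * \<bar>(\<alpha> - fst p) - (\<beta> - fst p)\<bar>
      \<le> \<bar>(f (\<alpha> - fst q) - f (\<alpha> - fst p)) - (f (\<beta> - fst q) - f (\<beta> - fst p))\<bar>"
    unfolding q by (rule increment_expanding) (use \<alpha> \<beta> q in \<open>auto simp: overlap_def\<close>)
  \<comment> \<open>Both increments of \<open>f\<close> lie within \<delta> of
    \<open>snd p - snd q\<close>.\<close>
  also have "\<dots> \<le> 2 * \<delta>" using \<alpha> \<beta> unfolding overlap_def by auto
  finally have "d * (c * \<bar>\<alpha> - \<beta>\<bar>) \<le> 2 * (M + 1) * (2 * \<delta>)" using M_nonneg by simp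
  then show ?thesis using d c unfolding d_def[symmetric] by (simp add: field_simps)
qed

text \<open>An enclosing interval replaces the overlap set because its indicator integrates
  explicitly. Centering it at one overlap point doubles the constant 4 to 8; for
  \<open>p = q\<close> the last quotient is 0 by convention.\<close>

lemma overlap_subset_interval:
  assumes "0 < \<delta>" "p \<noteq> q \<Longrightarrow> 2 * \<delta> \<le> l1_dist p q"
  obtains l r where "overlap \<delta> p q \<subseteq> {l..r}" "l \<le> r"
    "r - l \<le> (if p = q then b - a else 0) + 8 * (M + 1) / c * \<delta> / l1_dist p q"
proof (cases "p = q")
  case True
  then show thesis
    using that[of "a + fst p" "b + fst p"] ab by (force simp: overlap_def l1_dist_def)
next
  case False
  define D where "D = 4 * (M + 1) / c * \<delta> / l1_dist p q"
  have D: "0 \<le> D" using M_nonneg c assms False unfolding D_def by (auto intro!: divide_nonneg_nonneg mult_nonneg_nonneg)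
  have "\<exists>\<beta>. overlap \<delta> p q \<subseteq> {\<beta> - D..\<beta> + D}"
  proof (cases "overlap \<delta> p q = {}")
    case nonempty: False
    then obtain \<beta> where "\<beta> \<in> overlap \<delta> p q" by blast
    then have "overlap \<delta> p q \<subseteq> {\<beta> - D..\<beta> + D}"
      using overlap_dist_le[OF assms(1) assms(2)[OF False]] unfolding D_def by fastforce
    then show ?thesis by blast
  qed auto
  then obtain \<beta> where "overlap \<delta> p q \<subseteq> {\<beta> - D..\<beta> + D}" by blast
  moreover have "(\<beta> + D) - (\<beta> - D) \<le> 8 * (M + 1) / c * \<delta> / l1_dist p q"
    unfolding D_def by (simp add: algebra_simps)
  ultimately show thesis using that[of "\<beta> - D" "\<beta> + D"] D False by simp
qed

lemma favard_curve_length_ge: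
  assumes graph: "(\<lambda>x. (x, f x)) ` {a..b} \<subseteq> \<Gamma>"
    and meas: "\<And>\<alpha>. curve_proj \<Gamma> \<alpha> (four_corner_cantor n) \<in> sets borel"
    and n: "1 \<le> n"
  shows "ennreal ((b - a)\<^sup>2 / (b - a + 16 * (M + 1) / c) / real n)
           \<le> favard_curve_length \<Gamma> (four_corner_cantor n)"
proof -
  define \<delta> :: real where "\<delta> = 1 / 4 ^ n"
  define P where "P = cantor_corners n"
  define K where "K = 8 * (M + 1) / c"
  define H where "H = (b - a + 2 * K) * real n"
  \<comment> \<open>The first moment will be \<open>b - a\<close> and the second at most
    \<open>H\<close>; this \<open>t\<close> maximizes
    \<open>2 * t * (b - a) - t\<^sup>2 * H\<close>, with value
    \<open>(b - a)\<^sup>2 / H\<close>.\<close>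
  define t where "t = (b - a) / H"
  have \<delta>: "0 < \<delta>" by (simp add: \<delta>_def)
  have K: "0 \<le> K" using M_nonneg c by (simp add: K_def)
  have H: "0 < H" using ab K n by (simp add: H_def add_pos_nonneg)
  define covers where "covers p q l r \<longleftrightarrow> overlap \<delta> p q \<subseteq> {l..r} \<and> l \<le> r \<and>
      r - l \<le> (if p = q then b - a else 0) + K * \<delta> / l1_dist p q" for p q l r
  have "\<exists>l r. covers p q l r" if "p \<in> P" "q \<in> P" for p q
  proof -
    have "2 * \<delta> \<le> l1_dist p q" if "p \<noteq> q"
      using cantor_corners_separated[of p n q] \<open>p \<in> P\<close> \<open>q \<in> P\<close> that by (simp add: P_def \<delta>_def)
    from overlap_subset_interval[OF \<delta> this] show ?thesis unfolding covers_def K_def by blast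
  qed
  then obtain l r where "covers p q (l p q) (r p q)" if "p \<in> P" "q \<in> P" for p q
    by metis
  then have lr: "overlap \<delta> p q \<subseteq> {l p q..r p q}" "l p q \<le> r p q"
      "r p q - l p q \<le> (if p = q then b - a else 0) + K * \<delta> / l1_dist p q"
    if "p \<in> P" "q \<in> P" for p q
    using that unfolding covers_def by blast+
  define E where "E \<alpha> p = (if \<alpha> - fst p \<in> {a..b}
    then {snd p + f (\<alpha> - fst p)..snd p + f (\<alpha> - fst p) + \<delta>} else {})" for \<alpha> p
  \<comment> \<open>A lower bound for the slice at \<alpha>, built from indicators of fixed
    intervals so that its integral can be computed term by term.\<close>
  define G where "G \<alpha> = 2 * t * (\<Sum>p\<in>P. \<delta> * indicat_real {a + fst p..b + fst p} \<alpha>)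
    - t\<^sup>2 * (\<Sum>p\<in>P. \<Sum>q\<in>P. \<delta> * indicat_real {l p q..r p q} \<alpha>)" for \<alpha>
  have E_meas: "E \<alpha> p \<in> fmeasurable lborel" for \<alpha> p unfolding E_def by (auto simp: fmeasurable_def emeasure_lborel_Icc_eq)
  have first: "measure lborel (E \<alpha> p) = \<delta> * indicat_real {a + fst p..b + fst p} \<alpha>" for \<alpha> p
    using \<delta> unfolding E_def by (auto simp: indicator_def)
  have second: "measure lborel (E \<alpha> p \<inter> E \<alpha> q) \<le> \<delta> * indicat_real {l p q..r p q} \<alpha>"
    if "p \<in> P" "q \<in> P" for \<alpha> p q
  proof (cases "E \<alpha> p \<inter> E \<alpha> q = {}")
    case False
    then have "\<alpha> \<in> overlap \<delta> p q" unfolding E_def overlap_def by (auto split: if_splits)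
    then have "\<alpha> \<in> {l p q..r p q}" using lr(1)[OF that] by blast
    moreover have "measure lborel (E \<alpha> p \<inter> E \<alpha> q) \<le> measure lborel (E \<alpha> p)"
      using E_meas by (intro measure_mono_fmeasurable fmeasurableD fmeasurable.Int) auto
    moreover have "measure lborel (E \<alpha> p) \<le> \<delta>" using first \<delta> by (simp add: indicator_def)
    ultimately show ?thesis by simp
  qed (use \<delta> in simp)
  have G_le: "ennreal (G \<alpha>) \<le> emeasure lebesgue (curve_proj \<Gamma> \<alpha> (four_corner_cantor n))" for \<alpha>
  proof -
    have "G \<alpha> \<le> 2 * t * (\<Sum>p\<in>P. measure lborel (E \<alpha> p))
        - t\<^sup>2 * (\<Sum>p\<in>P. \<Sum>q\<in>P. measure lborel (E \<alpha> p \<inter> E \<alpha> q))"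
      unfolding G_def first by (intro diff_left_mono mult_left_mono sum_mono second) auto
    also have "\<dots> \<le> measure lborel (\<Union>p\<in>P. E \<alpha> p)"
      using E_meas by (intro measure_UN_ge_second_moment) (simp_all add: P_def)
    finally have "ennreal (G \<alpha>) \<le> emeasure lborel (\<Union>p\<in>P. E \<alpha> p)"
      using fmeasurable.finite_UN[of P "E \<alpha>" lborel] E_meas
      by (subst emeasure_eq_measure2) (auto simp: P_def fmeasurable_def intro: ennreal_leI)
    also have "\<dots> \<le> emeasure lborel (curve_proj \<Gamma> \<alpha> (four_corner_cantor n))"
    proof (intro emeasure_mono UN_least)
      show "E \<alpha> p \<subseteq> curve_proj \<Gamma> \<alpha> (four_corner_cantor n)" if "p \<in> P" for p
        using curve_proj_ge_graph[OF graph, of p n \<alpha>] that unfolding P_def E_def \<delta>_def by simp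
    qed (use meas in simp)
    also have "\<dots> = emeasure lebesgue (curve_proj \<Gamma> \<alpha> (four_corner_cantor n))"
      using meas by simp
    finally show ?thesis .
  qed
  have ind_int: "integrable lebesgue (\<lambda>\<alpha>. \<delta> * indicat_real {x..y} \<alpha>)" for x y :: real
    by (intro integrable_mult_right) (simp flip: lmeasurable_iff_integrable)
  have ind_integral: "(\<integral>\<alpha>. \<delta> * indicat_real {x..y} \<alpha> \<partial>lebesgue) = \<delta> * (y - x)" if "x \<le> y" for x y :: real
    using that by simp
  have first_int: "integrable lebesgue (\<lambda>\<alpha>. 2 * t * (\<Sum>p\<in>P. \<delta> * indicat_real {a + fst p..b + fst p} \<alpha>))"
    by (intro integrable_mult_right Bochner_Integration.integrable_sum ind_int)
  have second_int: "integrable lebesgue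
      (\<lambda>\<alpha>. t\<^sup>2 * (\<Sum>p\<in>P. \<Sum>q\<in>P. \<delta> * indicat_real {l p q..r p q} \<alpha>))"
    by (intro integrable_mult_right Bochner_Integration.integrable_sum ind_int)
  have G_int: "integrable lebesgue G"
    unfolding G_def by (rule Bochner_Integration.integrable_diff[OF first_int second_int])
  have "(\<Sum>p\<in>P. \<Sum>q\<in>P. r p q - l p q)
      \<le> (\<Sum>p\<in>P. \<Sum>q\<in>P. (if p = q then b - a else 0) + K * \<delta> / l1_dist p q)"
    by (intro sum_mono lr(3))
  \<comment> \<open>The diagonal contributes \<open>b - a\<close> for each of the
    \<open>4 ^ n\<close> corners; the remaining term is the energy.\<close>
  also have "\<dots> = 4 ^ n * (b - a) + K * \<delta> * (\<Sum>p\<in>P. \<Sum>q\<in>P. 1 / l1_dist p q)"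
    by (simp add: sum.distrib sum.delta P_def card_cantor_corners sum_distrib_left)
  also have "\<dots> \<le> 4 ^ n * (b - a) + K * \<delta> * (2 * real n * 16 ^ n)"
    using cantor_corners_energy[of n] K \<delta> unfolding P_def by (intro add_left_mono mult_left_mono) auto
  also have "\<dots> = 4 ^ n * (b - a + 2 * K * real n)"
    by (simp add: \<delta>_def field_simps flip: power_mult_distrib)
  also have "\<dots> \<le> 4 ^ n * H"
  proof -
    have "b - a \<le> (b - a) * real n" using ab n by simp
    then have "b - a + 2 * K * real n \<le> H" unfolding H_def by (simp add: algebra_simps)
    then show ?thesis by (rule mult_left_mono) simp
  qed
  finally have energy: "\<delta> * (\<Sum>p\<in>P. \<Sum>q\<in>P. r p q - l p q) \<le> H"
    by (simp add: \<delta>_def field_simps)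
  have "(b - a)\<^sup>2 / H = 2 * t * (b - a) - t\<^sup>2 * H"
    using H by (simp add: t_def power2_eq_square field_simps)
  also have "\<dots> \<le> 2 * t * (b - a) - t\<^sup>2 * (\<delta> * (\<Sum>p\<in>P. \<Sum>q\<in>P. r p q - l p q))"
    using energy by (intro diff_left_mono mult_left_mono) auto
  also have "\<dots> = 2 * t * (\<Sum>p\<in>P. \<delta> * (b - a)) - t\<^sup>2 * (\<Sum>p\<in>P. \<Sum>q\<in>P. \<delta> * (r p q - l p q))"
    by (simp add: P_def card_cantor_corners \<delta>_def sum_distrib_left)
  also have "\<dots> = integral\<^sup>L lebesgue G"
  proof -
    have "(\<integral>\<alpha>. (\<Sum>p\<in>P. \<delta> * indicat_real {a + fst p..b + fst p} \<alpha>) \<partial>lebesgue)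
        = (\<Sum>p\<in>P. \<delta> * (b - a))"
      using ab by (subst Bochner_Integration.integral_sum[OF ind_int]) (simp add: ind_integral)
    moreover have "(\<integral>\<alpha>. (\<Sum>p\<in>P. \<Sum>q\<in>P. \<delta> * indicat_real {l p q..r p q} \<alpha>) \<partial>lebesgue)
        = (\<Sum>p\<in>P. \<Sum>q\<in>P. \<delta> * (r p q - l p q))"
      by (subst Bochner_Integration.integral_sum[OF Bochner_Integration.integrable_sum[OF ind_int]],
          subst Bochner_Integration.integral_sum[OF ind_int])
        (intro sum.cong refl ind_integral lr(2))
    ultimately show ?thesis
      unfolding G_def Bochner_Integration.integral_diff[OF first_int second_int] by simp
  qed
  finally have "ennreal ((b - a)\<^sup>2 / H) \<le> ennreal (integral\<^sup>L lebesgue G)"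
    by (rule ennreal_leI)
  also have "\<dots> \<le> (\<integral>\<^sup>+ \<alpha>. ennreal (G \<alpha>) \<partial>lebesgue)"
  proof -
    \<comment> \<open>\<open>G\<close> may be negative, and \<open>ennreal\<close> truncates
      negative values to 0, so the comparison passes through the positive part.\<close>
    have "integral\<^sup>L lebesgue G \<le> (\<integral>\<alpha>. max 0 (G \<alpha>) \<partial>lebesgue)"
      using G_int by (intro integral_mono) auto
    then have "ennreal (integral\<^sup>L lebesgue G) \<le> ennreal (\<integral>\<alpha>. max 0 (G \<alpha>) \<partial>lebesgue)"
      by (rule ennreal_leI)
    also have "\<dots> = (\<integral>\<^sup>+ \<alpha>. ennreal (max 0 (G \<alpha>)) \<partial>lebesgue)"
      using G_int by (intro nn_integral_eq_integral[symmetric]) auto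
    also have "\<dots> = (\<integral>\<^sup>+ \<alpha>. ennreal (G \<alpha>) \<partial>lebesgue)"
      by (intro nn_integral_cong) (simp add: max_def ennreal_neg)
    finally show ?thesis .
  qed
  also have "\<dots> \<le> favard_curve_length \<Gamma> (four_corner_cantor n)"
    unfolding favard_curve_length_def by (intro nn_integral_mono G_le)
  finally show ?thesis by (simp add: H_def K_def)
qed

end

theorem corollary1p9:
  fixes \<Gamma> :: "(real \<times> real) set"
  assumes "piecewise_bi_lipschitz_tangent_curve \<Gamma>"
  shows "\<exists>c::real. c > 0 \<and>
    (\<forall>n::nat. n \<ge> 1 \<longrightarrow> favard_curve_length \<Gamma> (four_corner_cantor n) \<ge> ennreal (c / real n))"
proof -
  obtain C where C: "bi_lipschitz_tangent_curve C" "C \<subseteq> \<Gamma>"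
    using assms unfolding piecewise_bi_lipschitz_tangent_curve_def by blast
  obtain f f' a b c M where "slope_expanding f f' a b c M"
    and graph: "(\<lambda>x. (x, f x)) ` {a..b} \<subseteq> C"
    using bi_lipschitz_tangent_curve_contains_graph[OF C(1)] by blast
  then interpret slope_expanding f f' a b c M by simp
  have "0 < (b - a)\<^sup>2 / (b - a + 16 * (M + 1) / c)"
    using ab c M_nonneg by (intro divide_pos_pos add_pos_nonneg) auto
  \<comment> \<open>The graph lies in a single piece \<open>C\<close>, while the slices measured are
    those of all of \<Gamma>.\<close>
  moreover have "ennreal ((b - a)\<^sup>2 / (b - a + 16 * (M + 1) / c) / real n)
      \<le> favard_curve_length \<Gamma> (four_corner_cantor n)" if "1 \<le> n" for n
    by (rule favard_curve_length_ge[OF subset_trans[OF graph C(2)]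
          curve_proj_measurable[OF assms compact_four_corner_cantor] that])
  ultimately show ?thesis by blast
qed

end
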